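(* Let $f:\mathbb{R}^n\to\mathbb{R}$ be an $L_s$-RSS and $C^1$ function. Suppose that every nonempty sub-level set of $f$ contained in $C_s$ is bounded, i.e., for any $\alpha\in\mathbb{R}$ the set $\{\mathbf{x}\in C_s\mid f(\mathbf{x})\le\alpha\}$ is bounded. Consider an arbitrary $\gamma\in(0,\frac{1}{L_s}]$. Assume that (A.1) for any two distinct HT-stable stationary points $\mathbf{x}^*$ and $\mathbf{y}^*$ associated with $\gamma$, $f(\mathbf{x}^* )\ne f(\mathbf{y}^* )$. Then, for any $\mathbf{x}^0\in C_s$, the IHT sequence $(\mathbf{x}^k)_{k\ge0}$ associated with $\gamma$ and starting from $\mathbf{x}^0$ converges to a HT-stable stationary point associated with $\gamma$. The same convergence result also holds if (A.1) is replaced by the following assumption: (A.2) $0<\gamma<\frac{1}{L_s}$ and each HT-stable stationary point associated with $\gamma$ is isolated.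
   Context: Here $s,n$ are integers with $1\le s<n$, $\|\mathbf{x}\|_0$ is the number of nonzero entries of $\mathbf{x}$, $C_s=\{\mathbf{x}\in\mathbb{R}^n\mid\|\mathbf{x}\|_0\le s\}$, and the underlying problem is to minimize $f(\mathbf{x})$ subject to $\mathbf{x}\in C_s$. RSS: a differentiable $f:\mathbb{R}^n\to\mathbb{R}$ is $L_s$-RSS (restricted strongly smooth with modulus $L_s>0$) if $f(\mathbf{y})\le f(\mathbf{x})+\langle\nabla f(\mathbf{x}),\mathbf{y}-\mathbf{x}\rangle+\frac{L_s}{2}\|\mathbf{y}-\mathbf{x}\|_2^2$ for all $\mathbf{x},\mathbf{y}\in C_s$. Hard thresholding operator: $H_s(\mathbf{x})=\arg\min_{\|\mathbf{z}\|_0\le s}\|\mathbf{z}-\mathbf{x}\|_2$, a set of minimizers that may contain more than one element. An IHT sequence associated with stepsize $\gamma$ starting from $\mathbf{x}^0\in C_s$ is any sequence with $\mathbf{x}^{k+1}\in H_s(\mathbf{x}^k-\gamma\nabla f(\mathbf{x}^k))$ for $k=0,1,\dots$. $\mathcal{I}^{\mathbf{x}}_s\subset\{1,\dots,n\}$ denotes a set of $s$ indices of the $s$ largest entries of $\mathbf{x}$ in absolute value; $\mathrm{supp}(\mathbf{x})$ is the set of indices of nonzero entries; $\nabla_{\mathcal{J}}f(\mathbf{x})$ is the restriction of $\nabla f(\mathbf{x})$ to the entries indexed by $\mathcal{J}$. HT stationary points: for $\gamma>0$, a vector $\mathbf{x}^*\in C_s$ is a HT-stable stationary point associated with $\gamma$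 if $\nabla_{\mathrm{supp}(\mathbf{x}^* )}f(\mathbf{x}^* )=0$ and $$\min\big(|x^*_i|: i\in\mathcal{I}^{\mathbf{x}^*}_s\big)\ge\gamma\max\big(|\nabla_jf(\mathbf{x}^* )|: j\notin\mathrm{supp}(\mathbf{x}^* )\big)$$ (the left side does not depend on the choice of $\mathcal{I}^{\mathbf{x}^*}_s$). If $\nabla_{\mathrm{supp}(\mathbf{x}^* )}f(\mathbf{x}^* )=0$ but this inequality fails, $\mathbf{x}^*$ is a HT-unstable stationary point associated with $\gamma$. A HT stationary point is one that is HT-stable or HT-unstable. A HT-stable/unstable stationary point $\mathbf{x}^*$ associated with $\gamma\in(0,\frac{1}{L_s}]$ is isolated if there exists a neighborhood $\mathcal{N}$ of $\mathbf{x}^*$ such that $\mathcal{N}$ does not contain any HT stationary point other than $\mathbf{x}^*$. *)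

theory Defs
  imports "HOL-Analysis.Analysis"
begin

definition supp :: "real ^ 'n \<Rightarrow> 'n set" where
  "supp x = {i. x $ i \<noteq> 0}"

definition l0 :: "real ^ 'n \<Rightarrow> nat" where
  "l0 x = card (supp x)"

definition C :: "nat \<Rightarrow> (real ^ 'n) set" where
  "C s = {x. l0 x \<le> s}"

definition grad :: "(real ^ 'n \<Rightarrow> real) \<Rightarrow> real ^ 'n \<Rightarrow> real ^ 'n" where
  "grad f x = (THE D. GDERIV f x :> D)"

lemma grad_eqI:
  assumes "GDERIV f x :> D"
  shows "grad f x = D"
  unfolding grad_def
proof (rule the_equality)
  show "GDERIV f x :> D" by (rule assms)
next
  fix D' assume "GDERIV f x :> D'"
  then have "(\<lambda>h. h \<bullet> D') = (\<lambda>h. h \<bullet> D)"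
    using assms unfolding gderiv_def by (rule has_derivative_unique)
  then show "D' = D"
    by (simp add: fun_eq_iff vector_eq_ldot)
qed

lemma GDERIV_grad:
  assumes "f differentiable (at x)"
  shows "GDERIV f x :> grad f x"
proof -
  obtain f' where f': "(f has_derivative f') (at x)"
    using assms unfolding differentiable_def by blast
  then have "f' = (\<lambda>h. h \<bullet> adjoint f' 1)"
    using adjoint_works[OF has_derivative_linear[OF f'], where y = 1]
    by (auto simp: fun_eq_iff inner_commute)
  then have "GDERIV f x :> adjoint f' 1"
    using f' unfolding gderiv_def by simp
  then show ?thesis
    by (simp add: grad_eqI)
qed

definition C1 :: "(real ^ 'n \<Rightarrow> real) \<Rightarrow> bool" where
  "C1 f \<longleftrightarrow> (\<forall>x. f differentiable (at x)) \<and> continuous_on UNIV (grad f)"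

definition RSS :: "nat \<Rightarrow> real \<Rightarrow> (real ^ 'n \<Rightarrow> real) \<Rightarrow> bool" where
  "RSS s L f \<longleftrightarrow> L > 0 \<and> (\<forall>x. f differentiable (at x)) \<and>
     (\<forall>x \<in> C s. \<forall>y \<in> C s.
        f y \<le> f x + grad f x \<bullet> (y - x) + L / 2 * (norm (y - x))\<^sup>2)"

definition HT :: "nat \<Rightarrow> real ^ 'n \<Rightarrow> (real ^ 'n) set" where
  "HT s x = {z. is_arg_min (\<lambda>z. norm (z - x)) (\<lambda>z. l0 z \<le> s) z}"

definition IHT_seq ::
  "(real ^ 'n \<Rightarrow> real) \<Rightarrow> nat \<Rightarrow> real \<Rightarrow> real ^ 'n \<Rightarrow> (nat \<Rightarrow> real ^ 'n) \<Rightarrow> bool" where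
  "IHT_seq f s \<gamma> x0 x \<longleftrightarrow>
     x0 \<in> C s \<and> x 0 = x0 \<and> (\<forall>k. x (Suc k) \<in> HT s (x k - \<gamma> *\<^sub>R grad f (x k)))"

definition is_largest :: "nat \<Rightarrow> real ^ 'n \<Rightarrow> 'n set \<Rightarrow> bool" where
  "is_largest s x I \<longleftrightarrow> card I = s \<and> (\<forall>i \<in> I. \<forall>j \<in> - I. \<bar>x $ j\<bar> \<le> \<bar>x $ i\<bar>)"

text \<open>For \<open>s \<le> CARD('n)\<close> such an index set exists but need not be unique; the minimum of the
  absolute values over it is the same for every choice (shown below).\<close>

definition largest :: "nat \<Rightarrow> real ^ 'n \<Rightarrow> 'n set" where
  "largest s x = (SOME I. is_largest s x I)"

lemma is_largest_exists:
  fixes x :: "real ^ 'n"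
  assumes "s \<le> CARD('n)"
  shows "\<exists>I. is_largest s x I"
  using assms
proof (induction s)
  case 0
  show ?case by (rule exI[of _ "{}"]) (simp add: is_largest_def)
next
  case (Suc s)
  then obtain I where I: "card I = s" "\<forall>i \<in> I. \<forall>j \<in> - I. \<bar>x $ j\<bar> \<le> \<bar>x $ i\<bar>"
    unfolding is_largest_def by auto
  have "I \<noteq> UNIV"
    using I(1) Suc.prems by auto
  then have "- I \<noteq> {}" by blast
  then have "Max ((\<lambda>j. \<bar>x $ j\<bar>) ` (- I)) \<in> (\<lambda>j. \<bar>x $ j\<bar>) ` (- I)"
    by (intro Max_in) auto
  then obtain m where m: "m \<in> - I" "\<bar>x $ m\<bar> = Max ((\<lambda>j. \<bar>x $ j\<bar>) ` (- I))"
    by auto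
  have "\<forall>j \<in> - I. \<bar>x $ j\<bar> \<le> \<bar>x $ m\<bar>"
    using m(2) by simp
  then have "is_largest (Suc s) x (insert m I)"
    using I m(1) unfolding is_largest_def by auto
  then show ?case ..
qed

lemma is_largest_largest:
  fixes x :: "real ^ 'n"
  assumes "s \<le> CARD('n)"
  shows "is_largest s x (largest s x)"
  unfolding largest_def by (rule someI_ex[OF is_largest_exists[OF assms]])

lemma Min_is_largest_unique:
  fixes x :: "real ^ 'n"
  assumes "1 \<le> s" "is_largest s x I" "is_largest s x J"
  shows "Min ((\<lambda>i. \<bar>x $ i\<bar>) ` I) = Min ((\<lambda>i. \<bar>x $ i\<bar>) ` J)"
proof -
  have le: "Min ((\<lambda>i. \<bar>x $ i\<bar>) ` J) \<le> Min ((\<lambda>i. \<bar>x $ i\<bar>) ` I)"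
    if I: "is_largest s x I" and J: "is_largest s x J" for I J
  proof -
    have ne: "I \<noteq> {}" and card: "card I = card J"
      using I J assms(1) unfolding is_largest_def by auto
    have "Min ((\<lambda>i. \<bar>x $ i\<bar>) ` J) \<le> \<bar>x $ i\<bar>" if i: "i \<in> I" for i
    proof (cases "i \<in> J")
      case True
      then show ?thesis by simp
    next
      case False
      then have "\<not> J \<subseteq> I"
        using i card card_subset_eq[of I J] by auto
      then obtain j where j: "j \<in> J" "j \<notin> I" by blast
      then have "Min ((\<lambda>i. \<bar>x $ i\<bar>) ` J) \<le> \<bar>x $ j\<bar>" by simp
      also have "\<dots> \<le> \<bar>x $ i\<bar>"
        using I i j(2) unfolding is_largest_def by auto
      finally show ?thesis .
    qed
    then show ?thesis using ne by simp
  qed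
  show ?thesis
    by (rule antisym[OF le[OF assms(3,2)] le[OF assms(2,3)]])
qed

text \<open>Both index sets below are nonempty when \<open>x \<in> C s\<close> and \<open>1 \<le> s < CARD('n)\<close>, so that
  \<open>Min\<close> and \<open>Max\<close> are meaningful.\<close>

definition HT_ineq :: "(real ^ 'n \<Rightarrow> real) \<Rightarrow> nat \<Rightarrow> real \<Rightarrow> real ^ 'n \<Rightarrow> bool" where
  "HT_ineq f s \<gamma> x \<longleftrightarrow>
     Min ((\<lambda>i. \<bar>x $ i\<bar>) ` largest s x) \<ge> \<gamma> * Max ((\<lambda>j. \<bar>grad f x $ j\<bar>) ` (- supp x))"

definition HT_stable :: "(real ^ 'n \<Rightarrow> real) \<Rightarrow> nat \<Rightarrow> real \<Rightarrow> real ^ 'n \<Rightarrow> bool" where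
  "HT_stable f s \<gamma> x \<longleftrightarrow> x \<in> C s \<and> (\<forall>i \<in> supp x. grad f x $ i = 0) \<and> HT_ineq f s \<gamma> x"

definition HT_unstable :: "(real ^ 'n \<Rightarrow> real) \<Rightarrow> nat \<Rightarrow> real \<Rightarrow> real ^ 'n \<Rightarrow> bool" where
  "HT_unstable f s \<gamma> x \<longleftrightarrow> x \<in> C s \<and> (\<forall>i \<in> supp x. grad f x $ i = 0) \<and> \<not> HT_ineq f s \<gamma> x"

definition HT_stationary :: "(real ^ 'n \<Rightarrow> real) \<Rightarrow> nat \<Rightarrow> real \<Rightarrow> real ^ 'n \<Rightarrow> bool" where
  "HT_stationary f s \<gamma> x \<longleftrightarrow> HT_stable f s \<gamma> x \<or> HT_unstable f s \<gamma> x"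

end

theory Submission
  imports Defs
begin

text \<open>
  Write \<open>q\<^sub>x(z) = \<parallel>z - x\<parallel>\<^sup>2 + 2 \<gamma> \<langle>\<nabla>f(x), z - x\<rangle>\<close>. Up to a constant this is the squared distance of
  \<open>z\<close> from the gradient step \<open>x - \<gamma> \<nabla>f(x)\<close>, so one IHT step minimizes \<open>q\<^sub>x\<close> over \<open>C\<^sub>s\<close>. Restricted
  smoothness bounds \<open>f(y) - f(x)\<close> by \<open>q\<^sub>x(y) / (2 \<gamma>) - (1 / \<gamma> - L) / 2 \<cdot> \<parallel>y - x\<parallel>\<^sup>2\<close>. Since
  \<open>q\<^sub>x(x) = 0\<close>, a minimizer has \<open>q\<^sub>x(y) \<le> 0\<close>; hence \<open>f\<close> decreases along the iteration, the iterates
  stay in a bounded sublevel set, and the values \<open>f(x\<^sub>k)\<close> converge.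

  The central point is that every cluster point \<open>p\<close> is HT-stable, even for \<open>\<gamma> = 1 / L\<close>, where the
  descent inequality does not force the steps to vanish. Refining the subsequence so that the
  successors of its terms converge as well, to \<open>p'\<close> say, closedness of \<open>C\<^sub>s\<close> and continuity of the
  gradient show that \<open>p'\<close> minimizes \<open>q\<^sub>p\<close> over \<open>C\<^sub>s\<close>. But \<open>f(p') = f(p)\<close> is the limit of the values,
  so the descent inequality gives \<open>q\<^sub>p(p') \<ge> 0 = q\<^sub>p(p)\<close>. So \<open>p\<close> is itself a minimizer of \<open>q\<^sub>p\<close>, a fixed
  point of the iteration, and testing minimality against perturbations of one or two coordinates
  yields HT-stability (\<open>HT_fixed_point_imp_HT_stable\<close>, \<open>IHT_cluster_point_HT_stable\<close>).

  All cluster points share one value of \<open>f\<close>, so (A.1) leaves only one of them, and a bounded sequence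
  with a single cluster point converges. Under (A.2) the descent inequality is strict enough that the
  squared step lengths are at most a constant times the decrease of \<open>f\<close> and tend to zero; a bounded sequence whose
  steps vanish cannot leave an isolated cluster point without producing further cluster points
  nearby (\<open>tendsto_isolated_cluster_point\<close>).
\<close>

section \<open>Cluster points of bounded sequences\<close>

lemma frequently_in_closed_imp_cluster_point:
  fixes X :: "nat \<Rightarrow> 'a::heine_borel"
  assumes "bounded (range X)" and "closed A" and freq: "\<exists>\<^sub>F k in sequentially. X k \<in> A"
  obtains l r where "l \<in> A" "strict_mono r" "(X \<circ> r) \<longlonglongrightarrow> l"
proof -
  have inf: "infinite {k. X k \<in> A}"
    using freq by (simp add: frequently_cofinite flip: cofinite_eq_sequentially)
  define e where "e = enumerate {k. X k \<in> A}"
  have e: "strict_mono e" "X (e k) \<in> A" for k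
    using strict_mono_enumerate[OF inf] enumerate_in_set[OF inf, of k] by (auto simp: e_def)
  have "bounded (range (X \<circ> e))"
    by (rule bounded_subset[OF assms(1)]) auto
  then obtain l r where lr: "strict_mono r" "((X \<circ> e) \<circ> r) \<longlonglongrightarrow> l"
    using bounded_imp_convergent_subsequence by blast
  have "l \<in> A"
    using \<open>closed A\<close> _ lr(2) by (rule closed_sequentially) (simp add: e)
  moreover have "strict_mono (e \<circ> r)"
    using e(1) lr(1) by (rule strict_mono_o)
  ultimately show ?thesis
    using lr(2) that by (metis comp_assoc)
qed

lemma tendsto_unique_cluster_point:
  fixes X :: "nat \<Rightarrow> 'a::heine_borel"
  assumes "bounded (range X)"
    and uniq: "\<And>r q. strict_mono r \<Longrightarrow> (X \<circ> r) \<longlonglongrightarrow> q \<Longrightarrow> q = p"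
  shows "X \<longlonglongrightarrow> p"
proof (rule ccontr)
  assume "\<not> X \<longlonglongrightarrow> p"
  then obtain e where e: "e > 0" "\<exists>\<^sub>F k in sequentially. X k \<in> - ball p e"
    by (auto simp: tendsto_iff not_eventually dist_commute)
  obtain l r where "l \<in> - ball p e" "strict_mono r" "(X \<circ> r) \<longlonglongrightarrow> l"
    by (rule frequently_in_closed_imp_cluster_point[OF assms(1) _ e(2)]) auto
  then show False
    using uniq e(1) by auto
qed

text \<open>A sequence that keeps returning to \<open>p\<close> but also keeps leaving the ball of radius \<open>e\<close> must, once
  its steps are shorter than \<open>e / 2\<close>, land in the annulus \<open>e / 2 \<le> dist p \<cdot> \<le> e\<close> on each way out.
  The annulus is compact and thus contains a cluster point, which isolation of \<open>p\<close> forbids for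
  small \<open>e\<close>.\<close>

lemma tendsto_isolated_cluster_point:
  fixes X :: "nat \<Rightarrow> 'a::heine_borel"
  assumes "bounded (range X)"
    and steps: "(\<lambda>k. dist (X (Suc k)) (X k)) \<longlonglongrightarrow> 0"
    and cluster: "strict_mono r" "(X \<circ> r) \<longlonglongrightarrow> p"
    and "open T" "p \<in> T"
    and isol: "\<And>r q. strict_mono r \<Longrightarrow> (X \<circ> r) \<longlonglongrightarrow> q \<Longrightarrow> q \<in> T \<Longrightarrow> q = p"
  shows "X \<longlonglongrightarrow> p"
proof -
  obtain R where R: "R > 0" "cball p R \<subseteq> T"
    using \<open>open T\<close> \<open>p \<in> T\<close> open_contains_cball by blast
  have small: "\<forall>\<^sub>F k in sequentially. dist p (X k) < e" if e: "0 < e" "e \<le> R" for e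
  proof (rule ccontr)
    assume "\<not> ?thesis"
    then have out: "\<exists>k\<ge>M. e \<le> dist p (X k)" for M
      by (auto simp: not_eventually frequently_sequentially not_less)
    obtain N where N: "dist (X (Suc k)) (X k) < e / 2" if "k \<ge> N" for k
      using order_tendstoD(2)[OF steps, of "e / 2"] e(1) by (auto simp: eventually_sequentially)
    have near: "\<exists>k\<ge>M. dist p (X k) < e / 2" for M
    proof -
      obtain K where K: "dist (X (r k)) p < e / 2" if "k \<ge> K" for k
        using tendstoD[OF cluster(2), of "e / 2"] e(1) by (auto simp: eventually_sequentially)
      have "r (max K M) \<ge> M"
        using strict_mono_imp_increasing[OF cluster(1), of "max K M"] by simp
      then show ?thesis
        using K[of "max K M"] by (auto simp: dist_commute)
    qed
    have "\<exists>m\<ge>M. X m \<in> cball p e - ball p (e / 2)" for M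
    proof -
      obtain k where k: "k \<ge> max M N" "dist p (X k) < e / 2"
        using near by blast
      define P where "P = (\<lambda>m. m \<ge> k \<and> e / 2 \<le> dist p (X m))"
      obtain m0 where "P m0"
        using out[of k] e(1) by (force simp: P_def)
      then have m: "P (Least P)" and least: "\<And>j. j < Least P \<Longrightarrow> \<not> P j"
        by (auto intro: LeastI dest: not_less_Least)
      have "Least P \<noteq> k"
        using m k(2) by (auto simp: P_def)
      then obtain j where j: "Least P = Suc j" "j \<ge> k"
        using m by (cases "Least P") (auto simp: P_def)
      have "dist p (X j) < e / 2"
        using least[of j] j by (auto simp: P_def)
      moreover have "dist (X j) (X (Suc j)) < e / 2"
        using N[of j] j(2) k(1) by (simp add: dist_commute)
      ultimately have "dist p (X (Suc j)) \<le> e"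
        using dist_triangle[of p "X (Suc j)" "X j"] by simp
      then show ?thesis
        using m j k(1) by (intro exI[of _ "Suc j"]) (auto simp: P_def)
    qed
    then have freq: "\<exists>\<^sub>F m in sequentially. X m \<in> cball p e - ball p (e / 2)"
      by (simp add: frequently_sequentially)
    obtain l r' where l: "l \<in> cball p e - ball p (e / 2)" "strict_mono r'" "(X \<circ> r') \<longlonglongrightarrow> l"
      by (rule frequently_in_closed_imp_cluster_point[OF assms(1) _ freq]) auto
    then have "l = p"
      using R(2) e(2) by (intro isol[OF l(2,3)]) auto
    then show False
      using l(1) e(1) by simp
  qed
  show ?thesis
  proof (rule tendstoI)
    fix e :: real
    assume "e > 0"
    then have "\<forall>\<^sub>F k in sequentially. dist p (X k) < min e R"
      using R(1) by (intro small) auto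
    then show "\<forall>\<^sub>F k in sequentially. dist (X k) p < e"
      by eventually_elim (simp add: dist_commute)
  qed
qed

section \<open>Hard thresholding and its fixed points\<close>

text \<open>The sparse vectors form a finite union of coordinate subspaces.\<close>

lemma closed_C: "closed (C s :: (real ^ 'n) set)"
proof -
  have "C s = (\<Union>J \<in> {J :: 'n set. card J \<le> s}. {x :: real ^ 'n. \<forall>i \<in> - J. x $ i = 0})"
  proof (intro set_eqI iffI)
    fix x :: "real ^ 'n"
    assume "x \<in> C s"
    then show "x \<in> (\<Union>J \<in> {J. card J \<le> s}. {x. \<forall>i \<in> - J. x $ i = 0})"
      by (auto simp: C_def l0_def supp_def intro!: exI[of _ "supp x"])
  next
    fix x :: "real ^ 'n"
    assume "x \<in> (\<Union>J \<in> {J. card J \<le> s}. {x. \<forall>i \<in> - J. x $ i = 0})"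
    then obtain J where "card J \<le> s" "supp x \<subseteq> J"
      by (auto simp: supp_def)
    then show "x \<in> C s"
      using card_mono[of J "supp x"] by (auto simp: C_def l0_def)
  qed
  moreover have "closed {x :: real ^ 'n. \<forall>i \<in> - J. x $ i = 0}" for J
    unfolding Ball_def by (intro closed_Collect_all closed_Collect_imp closed_Collect_eq
        open_Collect_const continuous_intros)
  ultimately show ?thesis
    by (auto intro!: closed_UN)
qed

lemma HT_gradient_step_iff:
  "y \<in> HT s (x - \<gamma> *\<^sub>R g) \<longleftrightarrow> y \<in> C s \<and>
     (\<forall>z \<in> C s. (norm (y - x))\<^sup>2 + 2 * \<gamma> * (g \<bullet> (y - x)) \<le> (norm (z - x))\<^sup>2 + 2 * \<gamma> * (g \<bullet> (z - x)))"
proof -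
  have expand: "(norm (z - (x - \<gamma> *\<^sub>R g)))\<^sup>2
      = (norm (z - x))\<^sup>2 + 2 * \<gamma> * (g \<bullet> (z - x)) + \<gamma>\<^sup>2 * (norm g)\<^sup>2" for z
    unfolding power2_norm_eq_inner
    by (simp add: inner_diff_left inner_diff_right inner_commute algebra_simps power2_eq_square)
  have "norm (y - (x - \<gamma> *\<^sub>R g)) \<le> norm (z - (x - \<gamma> *\<^sub>R g)) \<longleftrightarrow>
      (norm (y - x))\<^sup>2 + 2 * \<gamma> * (g \<bullet> (y - x)) \<le> (norm (z - x))\<^sup>2 + 2 * \<gamma> * (g \<bullet> (z - x))" for z
    using abs_le_square_iff[of "norm (y - (x - \<gamma> *\<^sub>R g))" "norm (z - (x - \<gamma> *\<^sub>R g))"]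
    by (simp add: expand)
  then show ?thesis
    by (auto simp: HT_def is_arg_min_linorder C_def)
qed

text \<open>For a fixed point \<open>x\<close>, minimality says \<open>\<parallel>v\<parallel>\<^sup>2 + 2 \<gamma> \<langle>\<nabla>f(x), v\<rangle> \<ge> 0\<close> whenever \<open>x + v\<close> is still
  sparse. Moving one admissible coordinate to its value in the gradient step shows that the partial
  derivative vanishes there: on the support always, and everywhere if the support is not full. If it
  is full, exchanging a support index for an index outside compares \<open>\<bar>x\<^sub>i\<bar>\<close> with \<open>\<gamma> \<bar>\<nabla>\<^sub>j f(x)\<bar>\<close>.\<close>

lemma HT_fixed_point_imp_HT_stable:
  fixes f :: "real ^ 'n \<Rightarrow> real"
  assumes "1 \<le> s" "s < CARD('n)" "0 < \<gamma>"
    and fixed: "x \<in> HT s (x - \<gamma> *\<^sub>R grad f x)"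
  shows "HT_stable f s \<gamma> x"
proof -
  define g where "g = grad f x"
  have xC: "x \<in> C s"
    using fixed by (simp add: HT_gradient_step_iff)
  then have card: "card (supp x) \<le> s"
    by (simp add: C_def l0_def)
  have perturb: "0 \<le> v \<bullet> v + 2 * \<gamma> * (g \<bullet> v)" if "supp (x + v) \<subseteq> J" "card J \<le> s" for v J
  proof -
    have "x + v \<in> C s"
      using that card_mono[of J "supp (x + v)"] by (auto simp: C_def l0_def)
    then show ?thesis
      using fixed by (force simp: HT_gradient_step_iff g_def power2_norm_eq_inner)
  qed
  have single: "g $ i = 0" if "card (insert i (supp x)) \<le> s" for i
  proof -
    have "0 \<le> axis i (- \<gamma> * g $ i) \<bullet> axis i (- \<gamma> * g $ i) + 2 * \<gamma> * (g \<bullet> axis i (- \<gamma> * g $ i))"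
      by (rule perturb[OF _ that]) (auto simp: supp_def axis_def split: if_splits)
    then have "(\<gamma> * g $ i)\<^sup>2 \<le> 0"
      by (simp add: inner_axis inner_axis_axis power2_eq_square algebra_simps)
    then show ?thesis
      using \<open>0 < \<gamma>\<close> by simp
  qed
  have on_supp: "g $ i = 0" if "i \<in> supp x" for i
    using single[of i] card that by (simp add: insert_absorb)
  have largest: "is_largest s x (largest s x)"
    using assms(2) by (intro is_largest_largest) simp
  have bound: "\<gamma> * \<bar>g $ j\<bar> \<le> \<bar>x $ i\<bar>" if i: "i \<in> largest s x" and j: "j \<notin> supp x" for i j
  proof (cases "card (supp x) < s")
    case True
    then show ?thesis
      using single[of j] j by simp
  next
    case False
    then have full: "card (supp x) = s"
      using card by simp
    have "i \<in> supp x"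
    proof (rule ccontr)
      assume "i \<notin> supp x"
      then have "\<not> supp x \<subseteq> largest s x"
        using i full largest card_subset_eq[of "largest s x" "supp x"] by (auto simp: is_largest_def)
      then obtain k where "k \<in> supp x" "k \<notin> largest s x"
        by blast
      then have "\<bar>x $ k\<bar> \<le> \<bar>x $ i\<bar>" "x $ k \<noteq> 0"
        using i largest by (auto simp: is_largest_def supp_def)
      then show False
        using \<open>i \<notin> supp x\<close> by (simp add: supp_def)
    qed
    then have "i \<noteq> j" "g $ i = 0"
      using j on_supp by auto
    then have off: "axis i a $ j = 0" "axis j a $ i = 0" for a :: real
      by (auto simp: axis_def)
    define v where "v = axis i (- x $ i) + axis j (- \<gamma> * g $ j)"
    have "card (insert j (supp x - {i})) \<le> s"
      using full j \<open>i \<in> supp x\<close> card_Suc_Diff1[of "supp x" i] by simp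
    then have "0 \<le> v \<bullet> v + 2 * \<gamma> * (g \<bullet> v)"
      by (rule perturb[rotated]) (auto simp: v_def supp_def axis_def split: if_splits)
    also have "\<dots> = (x $ i)\<^sup>2 - (\<gamma> * g $ j)\<^sup>2"
      using \<open>i \<noteq> j\<close> \<open>g $ i = 0\<close>
      by (simp add: v_def off inner_axis inner_axis_axis power2_eq_square algebra_simps)
    finally have "\<bar>\<gamma> * g $ j\<bar> \<le> \<bar>x $ i\<bar>"
      by (simp add: abs_le_square_iff)
    then show ?thesis
      using \<open>0 < \<gamma>\<close> by (simp add: abs_mult)
  qed
  have "largest s x \<noteq> {}"
    using largest assms(1) by (auto simp: is_largest_def)
  moreover have "supp x \<noteq> UNIV"
    using card assms(2) by auto
  then have "Max ((\<lambda>j. \<bar>g $ j\<bar>) ` (- supp x)) \<in> (\<lambda>j. \<bar>g $ j\<bar>) ` (- supp x)"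
    by (intro Max_in) auto
  ultimately have "HT_ineq f s \<gamma> x"
    using bound by (auto simp: HT_ineq_def simp flip: g_def)
  then show ?thesis
    using xC on_supp by (simp add: HT_stable_def g_def)
qed

section \<open>Descent along the iteration\<close>

lemma IHT_seq_in_C:
  assumes "IHT_seq f s \<gamma> x0 x"
  shows "x k \<in> C s"
  using assms by (cases k) (auto simp: IHT_seq_def HT_gradient_step_iff)

lemma RSS_gradient_step_bound:
  assumes "RSS s L f" "0 < \<gamma>" "x \<in> C s" "y \<in> C s"
  shows "f y + (1 / \<gamma> - L) / 2 * (norm (y - x))\<^sup>2
    \<le> f x + ((norm (y - x))\<^sup>2 + 2 * \<gamma> * (grad f x \<bullet> (y - x))) / (2 * \<gamma>)"
proof -
  have "f y \<le> f x + grad f x \<bullet> (y - x) + L / 2 * (norm (y - x))\<^sup>2"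
    using assms by (auto simp: RSS_def)
  moreover have "((norm (y - x))\<^sup>2 + 2 * \<gamma> * (grad f x \<bullet> (y - x))) / (2 * \<gamma>)
      = (1 / \<gamma>) / 2 * (norm (y - x))\<^sup>2 + grad f x \<bullet> (y - x)"
    using \<open>0 < \<gamma>\<close> by (simp add: add_divide_distrib)
  moreover have "(1 / \<gamma> - L) / 2 * (norm (y - x))\<^sup>2
      = (1 / \<gamma>) / 2 * (norm (y - x))\<^sup>2 - L / 2 * (norm (y - x))\<^sup>2"
    by (simp add: left_diff_distrib diff_divide_distrib)
  ultimately show ?thesis
    by linarith
qed

lemma HT_gradient_step_descent:
  assumes "RSS s L f" "0 < \<gamma>" "x \<in> C s" "y \<in> HT s (x - \<gamma> *\<^sub>R grad f x)"
  shows "f y + (1 / \<gamma> - L) / 2 * (norm (y - x))\<^sup>2 \<le> f x"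
proof -
  have y: "y \<in> C s" "(norm (y - x))\<^sup>2 + 2 * \<gamma> * (grad f x \<bullet> (y - x)) \<le> 0"
    using assms(3,4) by (force simp: HT_gradient_step_iff)+
  then have "((norm (y - x))\<^sup>2 + 2 * \<gamma> * (grad f x \<bullet> (y - x))) / (2 * \<gamma>) \<le> 0"
    using \<open>0 < \<gamma>\<close> by (simp add: divide_nonpos_pos)
  then show ?thesis
    using RSS_gradient_step_bound[OF assms(1-3) y(1)] by simp
qed

lemma IHT_seq_decseq:
  assumes "RSS s L f" "0 < \<gamma>" "\<gamma> \<le> 1 / L" "IHT_seq f s \<gamma> x0 x"
  shows "decseq (\<lambda>k. f (x k))"
proof (rule decseq_SucI)
  fix k
  have "L \<le> 1 / \<gamma>"
    using assms(1-3) by (simp add: RSS_def field_simps)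
  then have "0 \<le> (1 / \<gamma> - L) / 2 * (norm (x (Suc k) - x k))\<^sup>2"
    by simp
  moreover have "f (x (Suc k)) + (1 / \<gamma> - L) / 2 * (norm (x (Suc k) - x k))\<^sup>2 \<le> f (x k)"
    using assms(4) IHT_seq_in_C[OF assms(4)]
    by (intro HT_gradient_step_descent[OF assms(1,2)]) (auto simp: IHT_seq_def)
  ultimately show "f (x (Suc k)) \<le> f (x k)"
    by linarith
qed

lemma IHT_seq_bounded:
  assumes "RSS s L f" "0 < \<gamma>" "\<gamma> \<le> 1 / L" "IHT_seq f s \<gamma> x0 x"
    and "\<forall>\<alpha>. bounded {x \<in> C s. f x \<le> \<alpha>}"
  shows "bounded (range x)"
proof (rule bounded_subset)
  show "bounded {y \<in> C s. f y \<le> f (x 0)}"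
    using assms(5) by blast
  show "range x \<subseteq> {y \<in> C s. f y \<le> f (x 0)}"
    using decseqD[OF IHT_seq_decseq[OF assms(1-4)], of 0] IHT_seq_in_C[OF assms(4)] by auto
qed

lemma IHT_seq_values_convergent:
  fixes f :: "real ^ 'n \<Rightarrow> real"
  assumes "RSS s L f" "0 < \<gamma>" "\<gamma> \<le> 1 / L" "IHT_seq f s \<gamma> x0 x"
    and "\<forall>\<alpha>. bounded {x \<in> C s. f x \<le> \<alpha>}"
  obtains \<phi> where "(\<lambda>k. f (x k)) \<longlonglongrightarrow> \<phi>"
proof -
  have "compact (closure (range x))"
    using IHT_seq_bounded[OF assms] by simp
  moreover have "continuous_on (closure (range x)) f"
    using assms(1) by (intro continuous_at_imp_continuous_on)
      (auto simp: RSS_def differentiable_imp_continuous_within)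
  ultimately have "bounded (f ` closure (range x))"
    using compact_continuous_image compact_imp_bounded by blast
  then have "bounded (f ` range x)"
    using bounded_subset closure_subset image_mono by metis
  then obtain B where "\<And>k. B \<le> f (x k)"
    using bounded_imp_bdd_below[of "f ` range x"] by (auto simp: bdd_below_def)
  then show ?thesis
    using decseq_convergent[OF IHT_seq_decseq[OF assms(1-4)], of B] that by auto
qed

text \<open>Strict inequality \<open>\<gamma> < 1 / L\<close> makes the coefficient of the squared step length in the descent
  inequality positive, and the decreases of a convergent sequence of values tend to zero.\<close>

lemma IHT_seq_steps_tendsto_0:
  fixes f :: "real ^ 'n \<Rightarrow> real"
  assumes "RSS s L f" "0 < \<gamma>" "\<gamma> < 1 / L" "IHT_seq f s \<gamma> x0 x"
    and "(\<lambda>k. f (x k)) \<longlonglongrightarrow> \<phi>"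
  shows "(\<lambda>k. dist (x (Suc k)) (x k)) \<longlonglongrightarrow> 0"
proof -
  define c where "c = (1 / \<gamma> - L) / 2"
  have c: "c > 0"
    using assms(1-3) by (simp add: c_def RSS_def field_simps)
  have step: "(dist (x (Suc k)) (x k))\<^sup>2 \<le> (f (x k) - f (x (Suc k))) / c" for k
  proof -
    have "f (x (Suc k)) + c * (norm (x (Suc k) - x k))\<^sup>2 \<le> f (x k)"
      unfolding c_def using assms(4) IHT_seq_in_C[OF assms(4)]
      by (intro HT_gradient_step_descent[OF assms(1,2)]) (auto simp: IHT_seq_def)
    then show ?thesis
      using c by (simp add: dist_norm field_simps)
  qed
  have "(\<lambda>k. (f (x k) - f (x (Suc k))) / c) \<longlonglongrightarrow> (\<phi> - \<phi>) / c"
    using assms(5) LIMSEQ_Suc[OF assms(5)] c by (intro tendsto_intros) auto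
  then have "(\<lambda>k. (f (x k) - f (x (Suc k))) / c) \<longlonglongrightarrow> 0"
    by simp
  then have "(\<lambda>k. (dist (x (Suc k)) (x k))\<^sup>2) \<longlonglongrightarrow> 0"
    by (rule Lim_null_comparison[rotated]) (simp add: step)
  then show ?thesis
    by simp
qed

text \<open>The successors of the subsequence converge to a minimizer \<open>q\<close> of the limiting step problem at
  \<open>p\<close>. Both limits have the same value of \<open>f\<close>, so the step from \<open>p\<close> to \<open>q\<close> gains nothing, and \<open>p\<close>
  attains the minimum too. The argument compares values of \<open>f\<close> only and never the points \<open>p\<close> and
  \<open>q\<close> themselves, so it covers the boundary case \<open>\<gamma> = 1 / L\<close>, where they might differ.\<close>

lemma IHT_cluster_point_HT_stable:
  fixes f :: "real ^ 'n \<Rightarrow> real"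
  assumes "1 \<le> s" "s < CARD('n)" and rss: "RSS s L f" and "C1 f" and "0 < \<gamma>" "\<gamma> \<le> 1 / L"
    and seq: "IHT_seq f s \<gamma> x0 x" and bdd: "bounded (range x)"
    and vals: "(\<lambda>k. f (x k)) \<longlonglongrightarrow> \<phi>"
    and r: "strict_mono r" "(x \<circ> r) \<longlonglongrightarrow> p"
  shows "HT_stable f s \<gamma> p" and "f p = \<phi>"
proof -
  have f_cont: "isCont f y" for y
    using rss by (auto simp: RSS_def differentiable_imp_continuous_within)
  have limit_value: "f y = \<phi>" if "filterlim e sequentially sequentially" "(\<lambda>k. x (e k)) \<longlonglongrightarrow> y" for e y
  proof (rule LIMSEQ_unique)
    show "(\<lambda>k. f (x (e k))) \<longlonglongrightarrow> f y"
      using f_cont that(2) by (rule isCont_tendsto_compose)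
    show "(\<lambda>k. f (x (e k))) \<longlonglongrightarrow> \<phi>"
      using vals that(1) by (rule filterlim_compose)
  qed
  have "bounded (range (\<lambda>k. x (Suc (r k))))"
    by (rule bounded_subset[OF bdd]) auto
  then obtain q t where t: "strict_mono t" and q: "(\<lambda>k. x (Suc (r (t k)))) \<longlonglongrightarrow> q"
    using bounded_imp_convergent_subsequence unfolding o_def by blast
  define e where "e = r \<circ> t"
  have e: "filterlim e sequentially sequentially"
    unfolding e_def using r(1) t by (intro filterlim_subseq strict_mono_o)
  have p: "(\<lambda>k. x (e k)) \<longlonglongrightarrow> p"
    using LIMSEQ_subseq_LIMSEQ[OF r(2) t] by (simp add: e_def o_def)
  have q: "(\<lambda>k. x (Suc (e k))) \<longlonglongrightarrow> q"
    using q by (simp add: e_def)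
  have pC: "p \<in> C s" and qC: "q \<in> C s"
    using closed_sequentially[OF closed_C _ p] closed_sequentially[OF closed_C _ q]
      IHT_seq_in_C[OF seq] by auto
  show fp: "f p = \<phi>"
    using limit_value[OF e p] .
  have fq: "f q = \<phi>"
    using limit_value[OF filterlim_compose[OF filterlim_Suc e] q] .
  have "isCont (grad f) p"
    using \<open>C1 f\<close> by (auto simp: C1_def continuous_on_eq_continuous_at)
  then have g: "(\<lambda>k. grad f (x (e k))) \<longlonglongrightarrow> grad f p"
    using p by (rule isCont_tendsto_compose)
  have q_min: "(norm (q - p))\<^sup>2 + 2 * \<gamma> * (grad f p \<bullet> (q - p))
      \<le> (norm (z - p))\<^sup>2 + 2 * \<gamma> * (grad f p \<bullet> (z - p))" if "z \<in> C s" for z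
  proof (rule LIMSEQ_le)
    show "(\<lambda>k. (norm (x (Suc (e k)) - x (e k)))\<^sup>2
        + 2 * \<gamma> * (grad f (x (e k)) \<bullet> (x (Suc (e k)) - x (e k))))
        \<longlonglongrightarrow> (norm (q - p))\<^sup>2 + 2 * \<gamma> * (grad f p \<bullet> (q - p))"
      by (intro tendsto_intros p q g)
    show "(\<lambda>k. (norm (z - x (e k)))\<^sup>2 + 2 * \<gamma> * (grad f (x (e k)) \<bullet> (z - x (e k))))
        \<longlonglongrightarrow> (norm (z - p))\<^sup>2 + 2 * \<gamma> * (grad f p \<bullet> (z - p))"
      by (intro tendsto_intros p g)
    have "x (Suc k) \<in> HT s (x k - \<gamma> *\<^sub>R grad f (x k))" for k
      using seq by (simp add: IHT_seq_def)
    then show "\<exists>N. \<forall>k\<ge>N. (norm (x (Suc (e k)) - x (e k)))\<^sup>2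
        + 2 * \<gamma> * (grad f (x (e k)) \<bullet> (x (Suc (e k)) - x (e k)))
        \<le> (norm (z - x (e k)))\<^sup>2 + 2 * \<gamma> * (grad f (x (e k)) \<bullet> (z - x (e k)))"
      using that by (auto simp: HT_gradient_step_iff)
  qed
  have "L \<le> 1 / \<gamma>"
    using rss assms(5,6) by (simp add: RSS_def field_simps)
  then have "0 \<le> (1 / \<gamma> - L) / 2 * (norm (q - p))\<^sup>2"
    by simp
  then have "0 \<le> ((norm (q - p))\<^sup>2 + 2 * \<gamma> * (grad f p \<bullet> (q - p))) / (2 * \<gamma>)"
    using RSS_gradient_step_bound[OF rss \<open>0 < \<gamma>\<close> pC qC] fp fq by linarith
  then have "0 \<le> (norm (q - p))\<^sup>2 + 2 * \<gamma> * (grad f p \<bullet> (q - p))"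
    using \<open>0 < \<gamma>\<close> by (simp add: zero_le_divide_iff)
  then have "p \<in> HT s (p - \<gamma> *\<^sub>R grad f p)"
    using q_min pC by (fastforce simp: HT_gradient_step_iff)
  then show "HT_stable f s \<gamma> p"
    using assms(1,2,5) by (intro HT_fixed_point_imp_HT_stable)
qed

section \<open>Convergence of iterative hard thresholding\<close>

theorem corollary5:
  fixes f :: "real ^ 'n \<Rightarrow> real" and s :: nat and L \<gamma> :: real
  assumes "1 \<le> s" and "s < CARD('n)"
    and "RSS s L f" and "C1 f"
    and "\<forall>\<alpha>. bounded {x \<in> C s. f x \<le> \<alpha>}"
    and "0 < \<gamma>" and "\<gamma> \<le> 1 / L"
  shows
    "((\<forall>x y. HT_stable f s \<gamma> x \<and> HT_stable f s \<gamma> y \<and> x \<noteq> y \<longrightarrow> f x \<noteq> f y)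
        \<longrightarrow> (\<forall>x0 \<in> C s. \<forall>x. IHT_seq f s \<gamma> x0 x
              \<longrightarrow> (\<exists>x'. HT_stable f s \<gamma> x' \<and> x \<longlonglongrightarrow> x')))
     \<and> (\<gamma> < 1 / L \<and> (\<forall>x. HT_stable f s \<gamma> x \<longrightarrow> x isolated_in {y. HT_stationary f s \<gamma> y})
        \<longrightarrow> (\<forall>x0 \<in> C s. \<forall>x. IHT_seq f s \<gamma> x0 x
              \<longrightarrow> (\<exists>x'. HT_stable f s \<gamma> x' \<and> x \<longlonglongrightarrow> x')))"
proof -
  have conv: "\<exists>x'. HT_stable f s \<gamma> x' \<and> x \<longlonglongrightarrow> x'"
    if seq: "IHT_seq f s \<gamma> x0 x"
      and alt: "(\<forall>x y. HT_stable f s \<gamma> x \<and> HT_stable f s \<gamma> y \<and> x \<noteq> y \<longrightarrow> f x \<noteq> f y) \<or>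
        \<gamma> < 1 / L \<and> (\<forall>x. HT_stable f s \<gamma> x \<longrightarrow> x isolated_in {y. HT_stationary f s \<gamma> y})"
    for x0 x
  proof -
    have bdd: "bounded (range x)"
      using IHT_seq_bounded[OF assms(3,6,7) seq assms(5)] .
    obtain \<phi> where vals: "(\<lambda>k. f (x k)) \<longlonglongrightarrow> \<phi>"
      using IHT_seq_values_convergent[OF assms(3,6,7) seq assms(5)] .
    note stable = IHT_cluster_point_HT_stable[OF assms(1-4,6,7) seq bdd vals]
    obtain p r where r: "strict_mono r" "(x \<circ> r) \<longlonglongrightarrow> p"
      using bounded_imp_convergent_subsequence[OF bdd] by blast
    have p: "HT_stable f s \<gamma> p" "f p = \<phi>"
      using stable[OF r] by auto
    from alt have "x \<longlonglongrightarrow> p"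
    proof
      assume "\<forall>x y. HT_stable f s \<gamma> x \<and> HT_stable f s \<gamma> y \<and> x \<noteq> y \<longrightarrow> f x \<noteq> f y"
      then show ?thesis
        using p stable by (intro tendsto_unique_cluster_point[OF bdd]) metis
    next
      assume iso: "\<gamma> < 1 / L \<and> (\<forall>x. HT_stable f s \<gamma> x \<longrightarrow> x isolated_in {y. HT_stationary f s \<gamma> y})"
      then obtain T where T: "open T" "T \<inter> {y. HT_stationary f s \<gamma> y} = {p}"
        using p(1) by (auto simp: isolated_in_def)
      have steps: "(\<lambda>k. dist (x (Suc k)) (x k)) \<longlonglongrightarrow> 0"
        using iso IHT_seq_steps_tendsto_0[OF assms(3,6) _ seq vals] by blast
      show ?thesis
      proof (rule tendsto_isolated_cluster_point[OF bdd steps r T(1)])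
        show "p \<in> T"
          using T(2) by blast
        show "q = p" if "strict_mono r'" "(x \<circ> r') \<longlonglongrightarrow> q" "q \<in> T" for r' q
          using T(2) stable(1)[OF that(1,2)] that(3) by (auto simp: HT_stationary_def)
      qed
    qed
    then show ?thesis
      using p(1) by blast
  qed
  then show ?thesis
    by blast
qed

end
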